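(* Let $\delta=\dfrac{3-4\ln 2}{4\ln 2-2}$ ($\approx 0.29435$). For any $\lambda\in(0,\delta)$ there exists $f\in\mathcal{U}(\lambda)$ with $a_3(f)>1+\lambda+\lambda^2$ (in particular $a_3(f)$ is real).
   Context: $\mathbb{D}=\{z\in\mathbb{C}:|z|<1\}$. $\mathcal{A}$ is the family of analytic functions $f$ in $\mathbb{D}$ with $f(0)=0=f'(0)-1$, and for $f\in\mathcal{A}$ we write $f(z)=z+\sum_{n=2}^{\infty}a_n(f)z^n$. For $0<\lambda\le1$, $\mathcal{U}(\lambda)$ is the set of $f\in\mathcal{A}$ with $\left|\left(\frac{z}{f(z)}\right)^2f'(z)-1\right|<\lambda$ for all $z\in\mathbb{D}$ (in particular $f$ does not vanish in $\mathbb{D}\setminus\{0\}$, and $z/f(z)$ is understood to be $1$ at $z=0$). *)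

theory Defs
  imports "HOL-Complex_Analysis.Complex_Analysis"
begin

definition class_A :: "(complex \<Rightarrow> complex) set" where
  "class_A = {f. f holomorphic_on ball 0 1 \<and> f 0 = 0 \<and> deriv f 0 = 1}"

definition taylor_coeff :: "(complex \<Rightarrow> complex) \<Rightarrow> nat \<Rightarrow> complex" where
  "taylor_coeff f n = fps_nth (fps_expansion f 0) n"

(* The removable singularity of z / f z at 0 is filled with the value 1 / f'(0) = 1. *)
definition z_over :: "(complex \<Rightarrow> complex) \<Rightarrow> complex \<Rightarrow> complex" where
  "z_over f z = (if z = 0 then 1 else z / f z)"

(* Only meant for 0 < lam \<le> 1. The non-vanishing of f off 0 is stated explicitly so that
   the definition does not rely on the convention z / 0 = 0. *)
definition class_U :: "real \<Rightarrow> (complex \<Rightarrow> complex) set" where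
  "class_U lam = {f \<in> class_A.
     (\<forall>z \<in> ball 0 1 - {0}. f z \<noteq> 0) \<and>
     (\<forall>z \<in> ball 0 1. norm ((z_over f z)\<^sup>2 * deriv f z - 1) < lam)}"

end

theory Submission
  imports Defs
begin

(* If Phi is a primitive of a function phi bounded by 1 on the closed unit disc, then
     g z = 1 - (1 + lam Phi 1) z + lam z Phi z
   satisfies g - z g' - 1 = - lam z^2 phi, and (z/f)^2 f' = g - z g' for f = z/g. Moreover
   g z = (1 - z) - lam z (Phi 1 - Phi z) cannot vanish in the disc, because Phi is 1-Lipschitz.
   So f belongs to U(lam), with a_3 = (1 + lam Phi 1)^2 - lam phi 0.
   For phi = 1 this is the conjectured bound 1 + lam + lam^2. Perturbing to the disc automorphism
   phi z = (z + c) / (1 + c z), with c slightly below 1, increases a_3: the derivative in c at 1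
   is lam (2 (1 + lam) (2 ln 2 - 1) - 1), which is negative exactly when lam < delta. *)

text \<open>Since \<open>f * g\<close> is the identity near 0, comparing coefficients in
  \<open>F * G = fps_X\<close> up to degree 3 determines those of \<open>f\<close> recursively. This
  avoids dividing power series.\<close>

lemma taylor_coeff_3_of_quotient:
  assumes f: "f analytic_on {0}" and g: "g analytic_on {0}"
    and fg: "eventually (\<lambda>z. f z * g z = z) (nhds 0)"
    and g0: "taylor_coeff g 0 = 1"
  shows "taylor_coeff f 3 = (taylor_coeff g 1)\<^sup>2 - taylor_coeff g 2"
proof -
  define F G where "F = fps_expansion f 0" and "G = fps_expansion g 0"
  have "(\<lambda>z. f z * g z) has_fps_expansion F * G"
    using f g unfolding F_def G_def
    by (intro fps_expansion_intros analytic_at_imp_has_fps_expansion_0)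
  moreover have "(\<lambda>z. f z * g z) has_fps_expansion fps_X"
    using has_fps_expansion_cong[OF fg refl] has_fps_expansion_fps_X by simp
  ultimately have FG: "F * G = fps_X"
    by (metis fps_expansion_unique_complex)
  have G0: "fps_nth G 0 = 1"
    using g0 by (simp add: taylor_coeff_def G_def)
  have "fps_nth (F * G) n = fps_nth fps_X n" for n
    using FG by simp
  from this[of 0] this[of 1] this[of 2] this[of 3] G0
  have F0: "fps_nth F 0 = 0" and F1: "fps_nth F 1 = 1"
    and F2: "fps_nth F 2 + fps_nth F 1 * fps_nth G 1 = 0"
    and F3: "fps_nth F 3 + fps_nth F 2 * fps_nth G 1 + fps_nth F 1 * fps_nth G 2 = 0"
    by (auto simp: fps_mult_nth eval_nat_numeral algebra_simps)
  from F1 F2 have "fps_nth F 2 = - fps_nth G 1"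
    by (simp add: eq_neg_iff_add_eq_0)
  with F1 F3 have "fps_nth F 3 = (fps_nth G 1)\<^sup>2 - fps_nth G 2"
    by (simp add: power2_eq_square algebra_simps)
  then show ?thesis
    by (simp add: taylor_coeff_def F_def G_def)
qed

text \<open>The hypotheses reach up to the boundary because \<open>P\<close> is evaluated at the
  boundary point 1 and compared there with its values inside.\<close>

lemma class_U_from_primitive:
  fixes P p :: "complex \<Rightarrow> complex"
  assumes lam: "0 < lam" "lam \<le> 1"
    and deriv_P: "\<And>z. z \<in> cball 0 1 \<Longrightarrow> (P has_field_derivative p z) (at z)"
    and p_le: "\<And>z. z \<in> cball 0 1 \<Longrightarrow> norm (p z) \<le> 1"
    and P0: "P 0 = 0"
  defines "f \<equiv> \<lambda>z. z / (1 - (1 + of_real lam * P 1) * z + of_real lam * z * P z)"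
  shows "f \<in> class_U lam" and "taylor_coeff f 3 = (1 + of_real lam * P 1)\<^sup>2 - of_real lam * p 0"
proof -
  define b where "b = 1 + of_real lam * P 1"
  define g where "g = (\<lambda>z. 1 - b * z + of_real lam * z * P z)"
  have f_eq: "f = (\<lambda>z. z / g z)"
    by (simp add: f_def g_def b_def)
  define g' where "g' = (\<lambda>z. - b + of_real lam * (P z + z * p z))"
  have deriv_g: "(g has_field_derivative g' z) (at z)" if "z \<in> ball 0 1" for z
    unfolding g_def g'_def using that
    by (auto intro!: derivative_eq_intros deriv_P simp: algebra_simps)
  have g_nz: "g z \<noteq> 0" if z: "z \<in> ball 0 1" for z
  proof
    assume "g z = 0"
    then have "1 - z = of_real lam * z * (P 1 - P z)"
      by (simp add: g_def b_def algebra_simps)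
    then have "norm (1 - z) = lam * norm z * norm (P 1 - P z)"
      using lam by (simp add: norm_mult)
    \<comment> \<open>The closed disc is convex and contains both \<open>z\<close> and 1, so the
      bound on \<open>p\<close> applies along the segment joining them.\<close>
    also have "norm (P 1 - P z) \<le> 1 * norm (1 - z)"
      using z by (intro field_differentiable_bound[of "cball 0 1" P p] p_le
          has_field_derivative_at_within[OF deriv_P]) auto
    finally have "norm (1 - z) \<le> (lam * norm z) * norm (1 - z)"
      using lam by (simp add: mult_left_mono)
    moreover have "lam * norm z < 1"
      using lam z mult_left_le_one_le[of "norm z" lam] by simp
    moreover have "norm (1 - z) > 0"
      using z by auto
    ultimately show False
      by simp
  qed
  have deriv_f: "(f has_field_derivative (g z - z * g' z) / (g z)\<^sup>2) (at z)"
    if "z \<in> ball 0 1" for z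
    unfolding f_eq using that g_nz[OF that]
    by (auto intro!: derivative_eq_intros deriv_g simp: power2_eq_square)
  have g0: "g 0 = 1"
    by (simp add: g_def)
  have hol_f: "f holomorphic_on ball 0 1"
    using deriv_f by (meson field_differentiable_def field_differentiable_at_within holomorphic_on_def)
  have hol_g: "g holomorphic_on ball 0 1"
    using deriv_g by (meson field_differentiable_def field_differentiable_at_within holomorphic_on_def)
  have hol_P: "P holomorphic_on ball 0 1"
    using deriv_P unfolding holomorphic_on_def
    by (metis field_differentiable_def field_differentiable_at_within ball_subset_cball subsetD)
  have f_A: "f \<in> class_A"
    using hol_f DERIV_imp_deriv[OF deriv_f[of 0]] by (simp add: class_A_def g0) (simp add: f_eq)
  have "norm ((z_over f z)\<^sup>2 * deriv f z - 1) < lam" if z: "z \<in> ball 0 1" for z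
  proof -
    \<comment> \<open>Here \<open>z_over f z = g z\<close> also at 0, where the filled-in value 1
      equals \<open>g 0\<close>; the square then cancels the denominator of the derivative of
      \<open>f\<close>.\<close>
    have "(z_over f z)\<^sup>2 * deriv f z = g z - z * g' z"
      using g_nz[OF z] DERIV_imp_deriv[OF deriv_f[OF z]]
      by (auto simp: z_over_def f_eq g0 field_simps)
    also have "\<dots> - 1 = - of_real lam * z\<^sup>2 * p z"
      by (simp add: g_def g'_def power2_eq_square algebra_simps)
    finally have "norm ((z_over f z)\<^sup>2 * deriv f z - 1) = lam * ((norm z)\<^sup>2 * norm (p z))"
      using lam by (simp add: norm_mult norm_power)
    also have "(norm z)\<^sup>2 * norm (p z) \<le> (norm z)\<^sup>2"
      using p_le[of z] z by (simp add: mult_left_le)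
    \<comment> \<open>Strictness comes from \<open>z\<close> lying in the open disc;
      \<open>norm (p z)\<close> may well equal 1.\<close>
    also have "(norm z)\<^sup>2 < 1"
      using z by (simp add: power_less_one_iff)
    finally show ?thesis
      using lam by simp
  qed
  then show "f \<in> class_U lam"
    using f_A g_nz by (auto simp: class_U_def f_eq)
  have an: "h analytic_on {0}" if "h holomorphic_on ball 0 1" for h :: "complex \<Rightarrow> complex"
    using that by (meson analytic_at centre_in_ball open_ball zero_less_one)
  define Q where "Q = fps_expansion P 0"
  have "g has_fps_expansion 1 - fps_const b * fps_X + fps_const (of_real lam) * fps_X * Q"
    unfolding g_def Q_def
    by (intro fps_expansion_intros analytic_at_imp_has_fps_expansion_0 an hol_P)
  then have G: "fps_expansion g 0 = 1 - fps_const b * fps_X + fps_const (of_real lam) * fps_X * Q"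
    using an[OF hol_g] analytic_at_imp_has_fps_expansion_0 fps_expansion_unique_complex by blast
  \<comment> \<open>The factor \<open>z\<close> in front of \<open>P\<close> shifts its coefficients
    by one: \<open>P 0 = 0\<close> leaves \<open>- b\<close> at degree 1, and the derivative of
    \<open>P\<close> at 0 enters at degree 2.\<close>
  have Q0: "fps_nth Q 0 = 0" and Q1: "fps_nth Q 1 = p 0"
    using P0 DERIV_imp_deriv[OF deriv_P[of 0]] by (simp_all add: Q_def fps_expansion_def)
  have "taylor_coeff g 0 = 1" "taylor_coeff g 1 = - b" "taylor_coeff g 2 = of_real lam * p 0"
    using Q0 Q1 by (simp_all add: taylor_coeff_def G mult.assoc numeral_2_eq_2)
  moreover have "eventually (\<lambda>z. f z * g z = z) (nhds 0)"
    unfolding eventually_nhds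
    by (intro exI[of _ "ball 0 1"]) (auto simp: f_eq g_nz)
  ultimately show "taylor_coeff f 3 = (1 + of_real lam * P 1)\<^sup>2 - of_real lam * p 0"
    using taylor_coeff_3_of_quotient[OF an[OF hol_f] an[OF hol_g]] by (simp flip: b_def)
qed

text \<open>The left side is the form that integrates at sight: a constant plus a multiple of the
  derivative of ln(1 + c z).\<close>

lemma disc_automorphism_partial_fraction:
  fixes c z :: "'a :: field"
  assumes "c \<noteq> 0" "1 + c * z \<noteq> 0"
  shows "1 / c - (1 - c\<^sup>2) / c\<^sup>2 * (c / (1 + c * z)) = (z + c) / (1 + c * z)"
proof -
  have "1 / c = (1 + c * z) / (c * (1 + c * z))"
    using assms(2) by simp
  moreover have "(1 - c\<^sup>2) / c\<^sup>2 * (c / (1 + c * z)) = (1 - c\<^sup>2) / (c * (1 + c * z))"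
    using assms(1) by (simp add: power2_eq_square)
  ultimately have "1 / c - (1 - c\<^sup>2) / c\<^sup>2 * (c / (1 + c * z))
      = ((1 + c * z) - (1 - c\<^sup>2)) / (c * (1 + c * z))"
    by (simp only: diff_divide_distrib)
  also have "(1 + c * z) - (1 - c\<^sup>2) = c * (z + c)"
    by (simp add: power2_eq_square algebra_simps)
  finally show ?thesis
    using assms(1) by simp
qed

lemma norm_disc_automorphism_le_1:
  fixes c :: real and z :: complex
  assumes "0 < c" "c < 1" "norm z \<le> 1"
  shows "norm ((z + of_real c) / (1 + of_real c * z)) \<le> 1"
proof -
  \<comment> \<open>Expanding both squares, the cross terms 2 c Re z cancel and the remainder
    factors.\<close>
  have "(norm (1 + of_real c * z))\<^sup>2 - (norm (z + of_real c))\<^sup>2 = (1 - c\<^sup>2) * (1 - (norm z)\<^sup>2)"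
    unfolding cmod_power2 by (simp add: power2_eq_square algebra_simps)
  moreover have "(1 - c\<^sup>2) * (1 - (norm z)\<^sup>2) \<ge> 0"
    using assms by (simp add: abs_square_le_1 power_le_one)
  ultimately have "(norm (z + of_real c))\<^sup>2 \<le> (norm (1 + of_real c * z))\<^sup>2"
    by (metis diff_ge_0_iff_ge)
  then have "norm (z + of_real c) \<le> norm (1 + of_real c * z)"
    by (rule power2_le_imp_le) (rule norm_ge_zero)
  then show ?thesis
    unfolding norm_divide by (intro divide_le_eq_1[THEN iffD2]) (metis norm_ge_zero order_le_less)
qed

theorem mainTheorem5:
  fixes lam :: real
  assumes "0 < lam" and "lam < (3 - 4 * ln 2) / (4 * ln 2 - 2)"
  shows "\<exists>f \<in> class_U lam.
           taylor_coeff f 3 \<in> \<real> \<and> Re (taylor_coeff f 3) > 1 + lam + lam\<^sup>2"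
proof -
  have ln2: "ln 2 \<ge> (2 / 3 :: real)"
    by (rule ln2_ge_two_thirds)
  \<comment> \<open>This is \<open>lam\<close> < \<delta> with the denominator cleared; ln 2 \<ge>
    2/3 makes that denominator positive and, below, gives \<delta> \<le> 1.\<close>
  then have slope: "2 * (1 + lam) * (2 * ln 2 - 1) < 1"
    using assms(2) by (simp add: field_simps)
  have "(3 - 4 * ln 2) / (4 * ln 2 - 2) \<le> (1 :: real)"
    using ln2 by (simp add: field_simps)
  then have lam1: "lam \<le> 1"
    using assms(2) by linarith
  \<comment> \<open>\<open>I c\<close> is the integral of (t + c) / (1 + c t) over [0, 1], which
    will be \<open>P 1\<close>; \<open>A c\<close> will be the third coefficient of the resulting
    function.\<close>
  define I where "I = (\<lambda>c :: real. 1 / c - (1 - c\<^sup>2) / c\<^sup>2 * ln (1 + c))"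
  define A where "A = (\<lambda>c. (1 + lam * I c)\<^sup>2 - lam * c)"
  \<comment> \<open>At 1 the factor 1 - c^2 vanishes, so the logarithm is not differentiated: 1/c
    contributes -1 and the other term 2 ln 2.\<close>
  have "(I has_real_derivative 2 * ln 2 - 1) (at 1)"
    unfolding I_def by (auto intro!: derivative_eq_intros)
  moreover have I1: "I 1 = 1"
    by (simp add: I_def)
  ultimately have "(A has_real_derivative lam * (2 * (1 + lam) * (2 * ln 2 - 1) - 1)) (at 1)"
    unfolding A_def by (auto intro!: derivative_eq_intros simp: algebra_simps)
  moreover have "lam * (2 * (1 + lam) * (2 * ln 2 - 1) - 1) < 0"
    using slope assms(1) by (simp add: mult_less_0_iff)
  ultimately obtain d where d: "d > 0" "\<And>h. 0 < h \<Longrightarrow> h < d \<Longrightarrow> A 1 < A (1 - h)"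
    using DERIV_neg_dec_left by blast
  \<comment> \<open>The step to the left of 1 is at most d/2, hence within the range where
    \<open>A\<close> exceeds \<open>A 1\<close>, and at most 1/2, which keeps \<open>c\<close>
    positive.\<close>
  define c where "c = 1 - min (d / 2) (1 / 2)"
  have c: "0 < c" "c < 1" and Ac: "A c > A 1"
    using d by (auto simp: c_def min_def)
  define p where "p = (\<lambda>z. (z + of_real c) / (1 + of_real c * z) :: complex)"
  define k where "k = (1 - c\<^sup>2) / c\<^sup>2"
  define P where "P = (\<lambda>z. z / of_real c - of_real k * Ln (1 + of_real c * z))"
  have deriv_P: "(P has_field_derivative p z) (at z)" if z: "z \<in> cball 0 1" for z
  proof -
    have "c * norm z \<le> c"
      using c z by (intro mult_left_le) auto
    then have "norm (of_real c * z) < 1"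
      using c unfolding norm_mult norm_of_real by linarith
    \<comment> \<open>Thus 1 + c z lies in the right half-plane, away from 0 and from the branch cut
      of \<open>Ln\<close>, even for z on the unit circle.\<close>
    then have "\<bar>Re (of_real c * z)\<bar> < 1"
      using abs_Re_le_cmod le_less_trans by blast
    then have pos: "Re (1 + of_real c * z) > 0"
      by simp
    then have nz: "1 + of_real c * z \<noteq> 0" and "1 + of_real c * z \<notin> \<real>\<^sub>\<le>\<^sub>0"
      by (force simp: complex_nonpos_Reals_iff)+
    then have "(P has_field_derivative 1 / of_real c
        - of_real k * (of_real c / (1 + of_real c * z))) (at z)"
      unfolding P_def using c by (auto intro!: derivative_eq_intros simp: divide_inverse)
    also have "complex_of_real k = (1 - (of_real c)\<^sup>2) / (of_real c)\<^sup>2"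
      by (simp add: k_def)
    also have "1 / of_real c - (1 - (of_real c)\<^sup>2) / (of_real c)\<^sup>2 * (of_real c / (1 + of_real c * z)) = p z"
      unfolding p_def using nz c by (intro disc_automorphism_partial_fraction) auto
    finally show ?thesis .
  qed
  have "norm (p z) \<le> 1" if "z \<in> cball 0 1" for z
    using norm_disc_automorphism_le_1[OF c, of z] that by (simp add: p_def)
  moreover have "P 0 = 0" and p0: "p 0 = of_real c"
    by (simp_all add: P_def p_def)
  ultimately obtain f where f: "f \<in> class_U lam"
      "taylor_coeff f 3 = (1 + of_real lam * P 1)\<^sup>2 - of_real lam * p 0"
    using class_U_from_primitive[OF assms(1) lam1 deriv_P] by blast
  \<comment> \<open>On positive reals \<open>Ln\<close> is the real logarithm, so \<open>P 1\<close>
    and with it the third coefficient are real.\<close>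
  have "Ln (1 + of_real c) = of_real (ln (1 + c))"
    using c Ln_of_real[of "1 + c"] by simp
  then have P1: "P 1 = of_real (I c)"
    by (simp add: P_def I_def k_def)
  have "taylor_coeff f 3 = of_real (A c)"
    by (simp add: f P1 p0 A_def)
  moreover have "A 1 = 1 + lam + lam\<^sup>2"
    by (simp add: A_def I1 power2_eq_square algebra_simps)
  ultimately show ?thesis
    using f(1) Ac by (intro bexI[of _ f]) auto
qed

end
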